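(* Let $\mathbf{d}=(d_0,d_1,d_2,\ldots)$ be the period-doubling sequence. For every positive integer $k$, the $t$-Hankel determinant $H_k(\mathbf{d},t)$ is a polynomial in $t$ of degree $k$ whose leading coefficient is the only one of its coefficients that is an odd integer. In other words, $$H_k(\mathbf{d},t)\equiv t^k \pmod 2.$$
   Context: The Thue--Morse sequence $\mathbf{e}=(e_0,e_1,\ldots)$ is defined by $\sum_{k\ge0}e_kx^k=\prod_{k\ge0}(1-x^{2^k})$. The period-doubling sequence $\mathbf{d}$ is defined by $d_k=\frac12|e_k-e_{k+1}|$ for $k\ge0$, so $\mathbf{d}=(1,0,1,1,1,0,\ldots)$. For a sequence $\mathbf{c}=(c_0,c_1,\ldots)$, a parameter $t$ and $k\ge1$, the $t$-Hankel determinant is $H_k(\mathbf{c},t)=\det(a_{ij})_{0\le i,j\le k-1}$ where $a_{ij}=c_{i+j}$ for $i\ne j$ and $a_{ii}=c_{2i}\,t$ (i.e. the ordinary Hankel determinant with every diagonal entry multiplied by $t$). A congruence of polynomials modulo $2$ means coefficientwise congruence. *)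

theory Defs
  imports "HOL-Computational_Algebra.Polynomial" "Jordan_Normal_Form.Determinant"
begin

text \<open>Thue--Morse sequence: coefficient of x^k in prod_{j>=0} (1 - x^(2^j)).
  Factors with 2^j > k do not affect the coefficient of x^k, so the finite
  product over j < k+1 (2^j > k for j = k) gives exactly the coefficient.\<close>
definition thue_morse :: "nat \<Rightarrow> int" where
  "thue_morse k = coeff (\<Prod>j<Suc k. (1 - monom 1 (2 ^ j) :: int poly)) k"

definition period_doubling :: "nat \<Rightarrow> int" where
  "period_doubling k = \<bar>thue_morse k - thue_morse (Suc k)\<bar> div 2"

definition t_hankel :: "(nat \<Rightarrow> int) \<Rightarrow> nat \<Rightarrow> int poly" where
  "t_hankel c k = det (mat k k (\<lambda>(i, j).
      if i = j then [:0, c (2 * i):] else [:c (i + j):]))"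

end

theory Submission
  imports Defs "HOL-Library.Z2" "HOL-Computational_Algebra.Polynomial_Factorial"
    "Jordan_Normal_Form.Char_Poly"
begin

text \<open>
  The sequence satisfies \<open>d(2n) = 1\<close> and \<open>d(2n+1) = 1 - d(n)\<close>, so in characteristic 2 the
  diagonal of the \<open>t\<close>-Hankel matrix is constantly \<open>t\<close>. Sorting the indices of the
  matrix of size \<open>2m\<close> into even and odd ones gives a block matrix with \<open>A\<close> on the diagonal and
  \<open>B\<close> off it, where \<open>A + B\<close> is the matrix of size \<open>m\<close>; hence \<open>H(2m) = H(m)\<^sup>2\<close>.
  For size \<open>2m+1\<close>, the Schur complement of the last entry equals the one for size \<open>m+1\<close>: the
  difference of the two is the value of the quadratic form of \<open>B\<close>, which is alternating. Hence
  \<open>H(2m+1) = H(m) H(m+1)\<close>, and \<open>H(k) = t\<^sup>k\<close> follows by induction. The Schur complements need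
  \<open>H(m) \<noteq> 0\<close> in a field, which is taken to be the rational functions over \<open>GF(2)\<close>.
\<close>

section \<open>Determinants: permuted indices, block matrices, bordering\<close>

text \<open>Rows and columns each contribute the sign of \<open>p\<close>, and the two signs
  cancel.\<close>

lemma det_permute_rows_cols:
  fixes f :: "nat \<Rightarrow> nat \<Rightarrow> 'a :: comm_ring_1"
  assumes p: "p permutes {0..<n}"
  shows "det (mat n n (\<lambda>(i, j). f (p i) (p j))) = det (mat n n (\<lambda>(i, j). f i j))"
proof -
  have lt: "p i < n" if "i < n" for i
    using permutes_in_image[OF p, of i] that by simp
  let ?A = "mat n n (\<lambda>(i, j). f i j)"
  let ?B = "mat n n (\<lambda>(i, j). f (p i) j)"
  let ?C = "mat n n (\<lambda>(i, j). f (p i) (p j))"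
  have "?B = mat n n (\<lambda>(i, j). ?A $$ (p i, j))"
    by (rule eq_matI) (auto simp: lt)
  then have B: "det ?B = signof p * det ?A"
    using det_permute_rows[OF _ p, of ?A] by simp
  have "det ?C\<^sup>T = det (mat n n (\<lambda>(i, j). ?B\<^sup>T $$ (p i, j)))"
    by (rule arg_cong[where f = det], rule eq_matI) (auto simp: lt)
  also have "\<dots> = signof p * det ?B\<^sup>T"
    by (rule det_permute_rows[OF _ p]) simp
  finally have "det ?C = signof p * det ?B"
    by (simp add: det_transpose[of _ n])
  moreover have "signof p * signof p = (1 :: 'a)"
    using signof_pm_one[of p, where 'a = 'a] by auto
  ultimately show ?thesis
    using B by (simp flip: mult.assoc)
qed

text \<open>Adding the second block column to the first and then subtracting the first block row
  from the second leaves a block upper triangular matrix with diagonal blocks \<open>A + B\<close>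
  and \<open>A - B\<close>.\<close>

lemma det_four_block_mat_symmetric:
  fixes A B :: "'a :: idom mat"
  assumes A: "A \<in> carrier_mat n n" and B: "B \<in> carrier_mat n n"
  shows "det (four_block_mat A B B A) = det (A + B) * det (A - B)"
proof -
  let ?L = "four_block_mat (1\<^sub>m n :: 'a mat) (0\<^sub>m n n) (- 1\<^sub>m n) (1\<^sub>m n)"
  let ?R = "four_block_mat (1\<^sub>m n :: 'a mat) (0\<^sub>m n n) (1\<^sub>m n) (1\<^sub>m n)"
  let ?X = "four_block_mat A B B A"
  have "?X * ?R = four_block_mat (A + B) B (B + A) A"
    using A B by (subst mult_four_block_mat[of _ n n _ n _ n _ _ n _ n]) auto
  then have "?L * (?X * ?R) = four_block_mat (A + B) B (- (A + B) + (B + A)) (- B + A)"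
    using A B by (simp, subst mult_four_block_mat[of _ n n _ n _ n _ _ n _ n]) auto
  also have "- (A + B) + (B + A) = 0\<^sub>m n n"
    using A B by (intro eq_matI) auto
  also have "- B + A = A - B"
    using A B by (intro eq_matI) auto
  finally have "det (?L * (?X * ?R)) = det (A + B) * det (A - B)"
    using A B det_four_block_mat_lower_left_zero[of "A + B" n B n "0\<^sub>m n n" "A - B"]
    by (simp add: minus_carrier_mat)
  moreover have "det (?L * (?X * ?R)) = det ?L * det (?X * ?R)"
    using A by (intro det_mult[of _ "n + n"] mult_carrier_mat[of _ _ "n + n"]) auto
  moreover have "det (?X * ?R) = det ?X * det ?R"
    using A by (intro det_mult[of _ "n + n"]) auto
  moreover have "det ?L = 1"
    by (subst det_four_block_mat_upper_right_zero[of _ n _ n]) auto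
  moreover have "det ?R = 1"
    by (subst det_four_block_mat_upper_right_zero[of _ n _ n]) auto
  ultimately show ?thesis by simp
qed

text \<open>Cramer's rule: the adjugate applied to \<open>v\<close> and divided by the determinant
  is a solution.\<close>

lemma det_nonzero_solve:
  fixes f :: "nat \<Rightarrow> nat \<Rightarrow> 'a :: field"
  assumes "det (mat n n (\<lambda>(i, j). f i j)) \<noteq> 0"
  obtains z where "\<And>i. i < n \<Longrightarrow> (\<Sum>j<n. f i j * z j) = v i"
proof -
  let ?A = "mat n n (\<lambda>(i, j). f i j)"
  define c where "c = inverse (det ?A)"
  define w where "w = c \<cdot>\<^sub>v (adj_mat ?A *\<^sub>v vec n v)"
  note adj = adj_mat[of ?A n, simplified]
  have w: "w \<in> carrier_vec n"
    using adj unfolding w_def by (auto intro!: mult_mat_vec_carrier)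
  have "?A *\<^sub>v (adj_mat ?A *\<^sub>v vec n v) = (?A * adj_mat ?A) *\<^sub>v vec n v"
    using adj(1) by (intro assoc_mult_mat_vec[of _ n n _ n, symmetric]) auto
  also have "\<dots> = det ?A \<cdot>\<^sub>v vec n v"
    by (subst adj(2)) (rule eq_vecI, auto simp: scalar_prod_def sum_distrib_left mult.assoc if_distrib
        if_distribR sum.delta cong: if_cong)
  finally have "?A *\<^sub>v w = c \<cdot>\<^sub>v (det ?A \<cdot>\<^sub>v vec n v)"
    unfolding w_def using adj
    by (subst mult_mat_vec[of _ n n]) (auto intro!: mult_mat_vec_carrier)
  also have "\<dots> = vec n v"
    using assms by (simp add: smult_smult_assoc c_def)
  finally have *: "?A *\<^sub>v w = vec n v" .
  have "(\<Sum>j<n. f i j * w $ j) = v i" if "i < n" for i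
  proof -
    have "v i = (?A *\<^sub>v w) $ i"
      using * that by simp
    also have "\<dots> = (\<Sum>j<n. f i j * w $ j)"
      using that w by (auto simp: scalar_prod_def lessThan_atLeast0 intro!: sum.cong)
    finally show ?thesis by simp
  qed
  then show thesis by (rule that)
qed

text \<open>Subtracting from the last column the combination of the others with weights
  \<open>y\<close> clears it above the corner, where the Schur complement remains. With
  \<open>y\<close> given, the leading block need not be inverted.\<close>

lemma det_bordered:
  fixes f :: "nat \<Rightarrow> nat \<Rightarrow> 'a :: idom"
  assumes y: "\<And>i. i < n \<Longrightarrow> (\<Sum>j<n. f i j * y j) = f i n"
  shows "det (mat (Suc n) (Suc n) (\<lambda>(i, j). f i j)) =
    det (mat n n (\<lambda>(i, j). f i j)) * (f n n - (\<Sum>j<n. f n j * y j))"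
proof -
  let ?A = "mat (Suc n) (Suc n) (\<lambda>(i, j). f i j)"
  let ?s = "f n n - (\<Sum>j<n. f n j * y j)"
  define U where "U = four_block_mat (1\<^sub>m n) (mat n 1 (\<lambda>(i, j). - y i)) (0\<^sub>m 1 n) (1\<^sub>m 1)"
  define V where "V = four_block_mat (mat n n (\<lambda>(i, j). f i j)) (0\<^sub>m n 1)
    (mat 1 n (\<lambda>(i, j). f n j)) (mat 1 1 (\<lambda>(i, j). ?s))"
  have A: "?A = four_block_mat (mat n n (\<lambda>(i, j). f i j)) (mat n 1 (\<lambda>(i, j). f i n))
    (mat 1 n (\<lambda>(i, j). f n j)) (mat 1 1 (\<lambda>(i, j). f n n))"
    by (rule eq_matI) (auto simp: less_Suc_eq)
  have "?A * U = V"
    unfolding A U_def V_def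
    by (subst mult_four_block_mat[of _ n n _ 1 _ 1 _ _ n _ 1];
        (rule cong_four_block_mat)?)
      (auto simp: scalar_prod_def sum_negf simp flip: lessThan_atLeast0
        intro!: eq_matI y[symmetric])
  moreover have "det (?A * U) = det ?A * det U"
    by (rule det_mult[of _ "Suc n"]) (auto simp: U_def)
  moreover have "det U = 1"
    unfolding U_def by (subst det_four_block_mat_lower_left_zero[of _ n _ 1]) auto
  moreover have "det V = det (mat n n (\<lambda>(i, j). f i j)) * ?s"
    unfolding V_def
    by (subst det_four_block_mat_upper_right_zero[of _ n _ 1]) (auto simp: det_single)
  ultimately show ?thesis by simp
qed

section \<open>Sums split by parity and arithmetic in characteristic 2\<close>

lemma sum_lessThan_double:
  fixes h :: "nat \<Rightarrow> 'a :: comm_monoid_add"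
  shows "(\<Sum>j<2 * m. h j) = (\<Sum>j<m. h (2 * j)) + (\<Sum>j<m. h (2 * j + 1))"
  by (induction m) (simp_all add: ac_simps)

lemma add_self_char2:
  fixes x :: "'a :: ring_1"
  assumes "(1 :: 'a) + 1 = 0"
  shows "x + x = 0"
proof -
  have "x + x = x * (1 + 1)" by (simp only: distrib_left mult_1_right)
  then show ?thesis by (simp only: assms mult_zero_right)
qed

lemma minus_eq_plus_char2:
  fixes x y :: "'a :: ring_1"
  assumes "(1 :: 'a) + 1 = 0"
  shows "x - y = x + y"
  using add_self_char2[OF assms, of y] by (metis add_diff_cancel_right diff_0_right add.assoc)

text \<open>The terms for (i, j) and (j, i) agree by symmetry and cancel in characteristic 2; the
  diagonal terms are zero.\<close>

lemma alternating_form_char2: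
  fixes B :: "nat \<Rightarrow> nat \<Rightarrow> 'a :: comm_ring_1"
  assumes two: "(1 :: 'a) + 1 = 0"
    and sym: "\<And>i j. B i j = B j i" and diag: "\<And>i. B i i = 0"
  shows "(\<Sum>i<n. z i * (\<Sum>j<n. B i j * z j)) = 0"
proof (induction n)
  case (Suc n)
  note dbl = add_self_char2[OF two]
  have "(\<Sum>i<Suc n. z i * (\<Sum>j<Suc n. B i j * z j)) =
    (\<Sum>i<n. z i * (\<Sum>j<n. B i j * z j)) +
    ((\<Sum>i<n. z i * (B i n * z n)) + z n * (\<Sum>j<n. B n j * z j))"
    by (simp add: diag distrib_left sum.distrib)
  also have "z n * (\<Sum>j<n. B n j * z j) = (\<Sum>i<n. z i * (B i n * z n))"
    by (subst sum_distrib_left, rule sum.cong) (simp_all add: sym[of n] ac_simps)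
  finally show ?case
    using Suc.IH dbl by simp
qed simp

section \<open>Hankel determinants over a field of characteristic 2\<close>

text \<open>The sign in \<open>d(2n+1) = 1 - d(n)\<close> is immaterial here. That \<open>t\<close>
  is nonzero keeps its powers nonzero, as the odd sizes require.\<close>

locale char2_period_doubling =
  fixes d :: "nat \<Rightarrow> 'a :: field" and t :: 'a
  assumes two: "(1 :: 'a) + 1 = 0" and t: "t \<noteq> 0"
    and d_even: "d (2 * n) = 1" and d_odd: "d (2 * n + 1) = 1 + d n"
begin

definition g :: "nat \<Rightarrow> nat \<Rightarrow> 'a" where
  "g i j = (if i = j then t else d (i + j))"

definition H :: "nat \<Rightarrow> 'a" where
  "H n = det (mat n n (\<lambda>(i, j). g i j))"

text \<open>\<open>B\<close> and \<open>A\<close> are the blocks of \<open>g\<close> for indices of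
  different and of equal parity.\<close>

definition B :: "nat \<Rightarrow> nat \<Rightarrow> 'a" where
  "B i j = 1 + d (i + j)"

definition A :: "nat \<Rightarrow> nat \<Rightarrow> 'a" where
  "A i j = (if i = j then t else 1)"

lemmas dbl = add_self_char2[OF two]

lemmas minus_char2 = minus_eq_plus_char2[OF two]

lemma dbl_left: "x + (x + y) = y" for x y :: 'a
  by (simp add: dbl flip: add.assoc)

lemma g_sym: "g i j = g j i"
  by (simp add: g_def add.commute)

lemma g_diag: "g i i = t"
  by (simp add: g_def)

lemma g_even_even: "g (2 * i) (2 * j) = A i j"
  using d_even[of "i + j"] by (simp add: g_def A_def)

lemma g_odd_odd: "g (2 * i + 1) (2 * j + 1) = A i j"
  using d_even[of "i + j + 1"] by (simp add: g_def A_def)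

lemma g_even_odd: "g (2 * i) (2 * j + 1) = B i j"
proof -
  have "2 * i \<noteq> 2 * j + 1" by presburger
  then show ?thesis
    using d_odd[of "i + j"] by (simp add: g_def B_def)
qed

lemma B_sym: "B i j = B j i"
  by (simp add: B_def add.commute)

lemma g_odd_even: "g (2 * i + 1) (2 * j) = B i j"
  using g_sym g_even_odd B_sym by metis

lemma B_diag: "B i i = 0"
  using d_even[of i] two by (simp add: B_def flip: mult_2)

lemma A_plus_B: "A i j + B i j = g i j"
  by (auto simp: A_def B_diag g_def) (simp add: B_def dbl_left)

lemma H_double: "H (2 * m) = H m ^ 2"
proof -
  \<comment> \<open>\<open>p\<close> lists the even indices first and then the odd ones, with
    \<open>q\<close> as its inverse below \<open>2 * m\<close>. It is the identity from
    \<open>2 * m\<close> on, as \<open>permutes\<close> demands.\<close>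
  define p where "p i = (if i < m then 2 * i else if i < 2 * m then 2 * (i - m) + 1 else i)" for i
  define q where "q i = (if even i then i div 2 else m + i div 2)" for i
  have "bij_betw p {0..<2 * m} {0..<2 * m}"
    by (rule bij_betw_byWitness[where f' = q]) (auto simp: p_def q_def elim!: evenE oddE)
  then have p: "p permutes {0..<2 * m}"
    by (rule bij_imp_permutes) (simp add: p_def)
  let ?A = "mat m m (\<lambda>(i, j). A i j)"
  let ?B = "mat m m (\<lambda>(i, j). B i j)"
  have "H (2 * m) = det (mat (2 * m) (2 * m) (\<lambda>(i, j). g (p i) (p j)))"
    unfolding H_def by (rule det_permute_rows_cols[OF p, symmetric])
  also have "mat (2 * m) (2 * m) (\<lambda>(i, j). g (p i) (p j)) = four_block_mat ?A ?B ?B ?A"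
    using g_even_even g_odd_odd g_even_odd g_odd_even
    by (intro eq_matI) (auto simp: p_def)
  also have "det \<dots> = det (?A + ?B) * det (?A - ?B)"
    by (rule det_four_block_mat_symmetric) auto
  also have "?A - ?B = ?A + ?B"
    by (rule eq_matI) (auto simp: minus_char2)
  also have "?A + ?B = mat m m (\<lambda>(i, j). g i j)"
    by (rule eq_matI) (auto simp: A_plus_B)
  finally show ?thesis
    by (simp add: H_def power2_eq_square)
qed

lemma H_double_plus_one:
  assumes nz: "H m \<noteq> 0"
  shows "H (2 * m + 1) = H m * H (Suc m)"
proof -
  note nz' = nz[unfolded H_def]
  define w where "w i = g i m" for i
  obtain z where z: "\<And>i. i < m \<Longrightarrow> (\<Sum>j<m. g i j * z j) = w i"
    by (rule det_nonzero_solve[OF nz', of w]) blast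
  define Bz where "Bz i = (\<Sum>j<m. B i j * z j)" for i
  \<comment> \<open>The border column of size \<open>2 * m + 1\<close> is 1 on even rows and
    \<open>1 + w\<close> on odd rows. If u and v are the even and odd parts of a solution, adding
    paired rows gives g(u + v) = w, so v = u + z. The even rows then become g u = 1 + Bz, and
    \<open>x\<close> is this u.\<close>
  obtain x where x: "\<And>i. i < m \<Longrightarrow> (\<Sum>j<m. g i j * x j) = 1 + Bz i"
    by (rule det_nonzero_solve[OF nz', of "\<lambda>i. 1 + Bz i"]) blast
  define y where "y j = (if even j then x (j div 2) else x (j div 2) + z (j div 2))" for j
  have y_even: "y (2 * j) = x j" and y_odd: "y (2 * j + 1) = x j + z j" for j
    by (simp_all add: y_def)
  have g_add: "(\<Sum>j<m. A i j * u j) + (\<Sum>j<m. B i j * u j) = (\<Sum>j<m. g i j * u j)" for i u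
    by (simp add: distrib_right flip: sum.distrib A_plus_B)
  have last_even: "g (2 * i) (2 * m) = 1" if "i < m" for i
    using that by (simp add: g_even_even A_def)
  have last_odd: "g (2 * i + 1) (2 * m) = 1 + w i" if "i < m" for i
    unfolding g_odd_even using that by (simp add: B_def w_def g_def)
  have solve: "(\<Sum>j<2 * m. g i j * y j) = g i (2 * m)" if "i < 2 * m" for i
  proof (cases "even i")
    case True
    then obtain a where "i = 2 * a" by (rule evenE)
    with that have a: "i = 2 * a" "a < m" by simp_all
    have "(\<Sum>j<2 * m. g i j * y j) = (\<Sum>j<m. A a j * x j) + (\<Sum>j<m. B a j * (x j + z j))"
      unfolding sum_lessThan_double a y_even y_odd g_even_even g_even_odd ..
    also have "\<dots> = (\<Sum>j<m. g a j * x j) + Bz a"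
      by (simp add: distrib_left sum.distrib Bz_def flip: g_add)
    also have "\<dots> = 1"
      using x[OF a(2)] by (simp add: dbl add.assoc)
    finally show ?thesis using a last_even by simp
  next
    case False
    then obtain a where a: "i = 2 * a + 1" by (rule oddE)
    with that have am: "a < m" by simp
    have "(\<Sum>j<2 * m. g i j * y j) = (\<Sum>j<m. B a j * x j) + (\<Sum>j<m. A a j * (x j + z j))"
      unfolding sum_lessThan_double a y_even y_odd g_odd_even g_odd_odd ..
    also have "\<dots> = (\<Sum>j<m. g a j * x j) + (\<Sum>j<m. A a j * z j)"
      by (simp add: distrib_left sum.distrib flip: g_add)
    also have "(\<Sum>j<m. A a j * z j) = w a + Bz a"
      unfolding z[OF am, symmetric] g_add[of a z, symmetric] Bz_def by (simp add: add.assoc dbl)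
    also have "(\<Sum>j<m. g a j * x j) + (w a + Bz a) = 1 + w a"
      using x[OF am] dbl_left[of "Bz a" "1 + w a"] by (simp add: ac_simps)
    finally show ?thesis using a am last_odd by simp
  qed
  \<comment> \<open>Symmetry of \<open>g\<close> moves the matrix from \<open>z\<close> to \<open>x\<close>; then the alternating part drops out.\<close>
  have wx: "(\<Sum>i<m. w i * x i) = (\<Sum>i<m. z i)"
  proof -
    have "(\<Sum>i<m. w i * x i) = (\<Sum>i<m. \<Sum>j<m. g i j * z j * x i)"
      by (simp add: sum_distrib_right flip: z)
    also have "\<dots> = (\<Sum>j<m. \<Sum>i<m. g i j * z j * x i)"
      by (rule sum.swap)
    also have "\<dots> = (\<Sum>j<m. z j * (\<Sum>i<m. g j i * x i))"
      by (simp add: sum_distrib_left g_sym ac_simps)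
    also have "\<dots> = (\<Sum>j<m. z j) + (\<Sum>j<m. z j * Bz j)"
      by (simp add: x distrib_left sum.distrib)
    also have "(\<Sum>j<m. z j * Bz j) = 0"
      unfolding Bz_def by (rule alternating_form_char2[OF two B_sym B_diag])
    finally show ?thesis by simp
  qed
  \<comment> \<open>Once the odd half is expanded, the sum of \<open>x\<close> occurs twice, and so
    does that of \<open>z\<close>, because of \<open>wx\<close>. What survives is the term in the
    Schur complement for size \<open>Suc m\<close>.\<close>
  have "(\<Sum>j<2 * m. g (2 * m) j * y j) =
      (\<Sum>j<m. x j) + (\<Sum>j<m. (1 + w j) * (x j + z j))"
    unfolding sum_lessThan_double y_even y_odd
    by (simp add: last_even last_odd[simplified] g_sym[of "2 * m"])
  also have "\<dots> = (\<Sum>j<m. x j) + ((\<Sum>j<m. x j) +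
      ((\<Sum>j<m. z j) + ((\<Sum>j<m. z j) + (\<Sum>j<m. w j * z j))))"
    by (simp add: ring_distribs sum.distrib wx ac_simps)
  finally have border: "(\<Sum>j<2 * m. g (2 * m) j * y j) = (\<Sum>j<m. w j * z j)"
    by (simp add: dbl_left)
  have "H (Suc (2 * m)) = H (2 * m) * (t - (\<Sum>j<m. w j * z j))"
    unfolding H_def using det_bordered[of "2 * m" g y, OF solve] by (simp only: border g_diag)
  moreover have "H (Suc m) = H m * (t - (\<Sum>j<m. w j * z j))"
    unfolding H_def using det_bordered[of m g z] z
    by (simp add: w_def g_diag g_sym[of m])
  ultimately show ?thesis
    by (simp add: H_double power2_eq_square)
qed

lemma H_eq_power: "H n = t ^ n"
proof (induction n rule: less_induct)
  case (less n)
  \<comment> \<open>Size 1 stands apart because the odd step reduces \<open>2 * m + 1\<close> to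
    \<open>m\<close> and \<open>m + 1\<close>, and the latter is smaller only for
    \<open>m > 0\<close>.\<close>
  consider "n = 0" | "n = 1" | m where "n = 2 * m" "m > 0" | m where "n = 2 * m + 1" "m > 0"
    by (metis evenE oddE gr0I mult_0_right add_0)
  then show ?case
  proof cases
    case 1
    then show ?thesis by (simp add: H_def)
  next
    case 2
    then show ?thesis by (simp add: H_def det_single g_diag)
  next
    case (3 m)
    then have "H m = t ^ m" by (intro less) simp
    then show ?thesis
      unfolding 3 H_double by (simp add: power_mult mult.commute)
  next
    case (4 m)
    then have m: "H m = t ^ m" and m1: "H (Suc m) = t ^ Suc m"
      by (intro less; simp)+
    with t have "H m \<noteq> 0" by simp
    then show ?thesis
      unfolding 4 H_double_plus_one[OF \<open>H m \<noteq> 0\<close>] m m1 by (simp add: mult_2 flip: power_add)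
  qed
qed

end

section \<open>Recurrences for the Thue-Morse and period-doubling sequences\<close>

abbreviation tm_poly :: "nat \<Rightarrow> int poly" where
  "tm_poly n \<equiv> \<Prod>j<n. (1 - monom 1 (2 ^ j))"

lemma coeff_tm_poly_Suc:
  "coeff (tm_poly (Suc n)) k =
    coeff (tm_poly n) k - (if 2 ^ n \<le> k then coeff (tm_poly n) (k - 2 ^ n) else 0)"
  by (simp add: algebra_simps coeff_monom_mult)

text \<open>This is P_{n+1}(x) = (1 - x) P_n(x^2) for the partial products. The induction removes
  the top factor: a shift by \<open>2 ^ Suc n\<close> at \<open>2 * k\<close> or
  \<open>2 * k + 1\<close> matches a shift by \<open>2 ^ n\<close> at \<open>k\<close>.\<close>

lemma coeff_tm_poly_double:
  "coeff (tm_poly (Suc n)) (2 * k) = coeff (tm_poly n) k"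
  "coeff (tm_poly (Suc n)) (2 * k + 1) = - coeff (tm_poly n) k"
proof (induction n arbitrary: k)
  case 0
  {
    case 1
    show ?case by simp
  next
    case 2
    show ?case by simp
  }
next
  case (Suc n)
  {
    case 1
    have "2 * k - 2 ^ Suc n = 2 * (k - 2 ^ n)" by simp
    then show ?case
      unfolding coeff_tm_poly_Suc[of "Suc n"] Suc.IH coeff_tm_poly_Suc[of n k]
      by (simp only: Suc.IH) simp
  next
    case 2
    have eq: "2 * k + 1 - 2 ^ Suc n = 2 * (k - 2 ^ n) + 1" if "2 ^ n \<le> k"
      using that by simp
    have le: "2 ^ Suc n \<le> 2 * k + 1 \<longleftrightarrow> 2 ^ n \<le> k" by simp presburger
    show ?case
    proof (cases "2 ^ n \<le> k")
      case True
      then show ?thesis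
        unfolding coeff_tm_poly_Suc[of "Suc n"] coeff_tm_poly_Suc[of n k] le
        by (simp only: Suc.IH eq[OF True]) simp
    next
      case False
      then show ?thesis
        unfolding coeff_tm_poly_Suc[of "Suc n"] coeff_tm_poly_Suc[of n k] le
        by (simp only: Suc.IH) simp
    qed
  }
qed

lemma coeff_tm_poly_stable:
  "k < 2 ^ n \<Longrightarrow> n \<le> n' \<Longrightarrow> coeff (tm_poly n') k = coeff (tm_poly n) k"
proof (rotate_tac, induction n' rule: dec_induct)
  case (step m)
  then have "k < 2 ^ m"
    by (meson less_le_trans one_le_numeral power_increasing)
  then show ?case
    using step unfolding coeff_tm_poly_Suc by simp
qed simp

lemma thue_morse_eq_coeff: "k < n \<Longrightarrow> coeff (tm_poly n) k = thue_morse k"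
  unfolding thue_morse_def
  by (rule coeff_tm_poly_stable) (auto intro: less_trans[OF less_exp])

lemma thue_morse_double:
  "thue_morse (2 * k) = thue_morse k"
  "thue_morse (2 * k + 1) = - thue_morse k"
proof -
  show "thue_morse (2 * k) = thue_morse k"
    \<comment> \<open>With \<open>2 * k + 1\<close> factors on the right and one more on the left,
      both coefficients have already stabilised.\<close>
    using coeff_tm_poly_double(1)[of "2 * k + 1" k] by (simp only: thue_morse_eq_coeff)
  show "thue_morse (2 * k + 1) = - thue_morse k"
    using coeff_tm_poly_double(2)[of "2 * k + 1" k] by (simp only: thue_morse_eq_coeff)
qed

lemma thue_morse_range: "thue_morse k \<in> {1, -1}"
proof (induction k rule: less_induct)
  case (less k)
  consider "k = 0" | m where "k = 2 * m" "m < k" | m where "k = 2 * m + 1" "m < k"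
    by (cases "k = 0"; cases "even k") (auto elim!: evenE oddE)
  then show ?case
  proof cases
    case 1
    then show ?thesis by (simp add: thue_morse_def)
  next
    case (2 m)
    then show ?thesis using less[of m] by (simp add: thue_morse_double)
  next
    case (3 m)
    then show ?thesis using less[of m] thue_morse_double(2)[of m] by auto
  qed
qed

lemma period_doubling_even: "period_doubling (2 * n) = 1"
  using thue_morse_range[of n] thue_morse_double[of n] by (auto simp: period_doubling_def)

text \<open>The entries involved are -e_n and e_{n+1}. For two signs, exactly one of their sum and
  difference vanishes, and the other is 2 in absolute value.\<close>

lemma period_doubling_odd: "period_doubling (2 * n + 1) = 1 - period_doubling n"
proof -
  have "thue_morse (Suc (2 * n + 1)) = thue_morse (Suc n)"
    using thue_morse_double(1)[of "Suc n"] by simp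
  then show ?thesis
    using thue_morse_range[of n] thue_morse_range[of "Suc n"] thue_morse_double(2)[of n]
    by (auto simp: period_doubling_def)
qed

section \<open>Reduction modulo 2 and conclusion\<close>

lemma of_int_bit_eq_one_iff: "(of_int n :: bit) = 1 \<longleftrightarrow> odd n"
proof (cases "even n")
  case False
  then obtain m where "n = 2 * m + 1" by (rule oddE)
  then show ?thesis by simp
qed (auto elim!: evenE)

text \<open>A ring homomorphism commutes with \<open>det\<close>, so the computation moves to the
  rational functions over GF(2); injectivity of \<open>to_fract\<close> brings the result
  back.\<close>

lemma map_poly_of_int_t_hankel:
  "map_poly of_int (t_hankel period_doubling k) = (monom 1 k :: bit poly)"
proof -
  interpret fr: comm_ring_hom "to_fract :: bit poly \<Rightarrow> bit poly fract"
    by unfold_locales auto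
  define h :: "int poly \<Rightarrow> bit poly fract" where "h p = to_fract (map_poly of_int p)" for p
  interpret h: comm_ring_hom h
    unfolding h_def by unfold_locales (auto simp: of_int_poly_hom.hom_add of_int_poly_hom.hom_mult)
  define d where "d n = h [:period_doubling n:]" for n
  define t :: "bit poly fract" where "t = to_fract (monom 1 1)"
  have two: "(1 :: bit poly fract) + 1 = 0"
  proof -
    have "(1 :: bit poly) + 1 = 0"
      unfolding poly_eq_iff coeff_add by auto
    then show ?thesis
      by (metis to_fract_0 to_fract_1 to_fract_add)
  qed
  have one: "h [:1:] = 1"
    using h.hom_one by (simp add: one_pCons)
  interpret char2_period_doubling d t
  proof
    show "d (2 * n) = 1" for n
      by (simp add: d_def period_doubling_even one)
    show "d (2 * n + 1) = 1 + d n" for n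
    proof -
      have "[:1 - period_doubling n:] = [:1:] - [:period_doubling n:]" by simp
      then have "h [:1 - period_doubling n:] = 1 - h [:period_doubling n:]"
        by (simp only: h.hom_minus one)
      then show ?thesis
        unfolding d_def period_doubling_odd minus_eq_plus_char2[OF two] .
    qed
  qed (use two in \<open>simp_all add: t_def\<close>)
  have hX: "h [:0, 1:] = t"
    by (simp add: h_def t_def monom_altdef of_int_hom.map_poly_pCons_hom)
  have "h (t_hankel period_doubling k) = H k"
    unfolding t_hankel_def H_def h.hom_det[symmetric]
    by (rule arg_cong[where f = det], rule eq_matI)
      (auto simp: g_def d_def period_doubling_even hX)
  also have "\<dots> = to_fract (monom 1 1 ^ k)"
    unfolding H_eq_power by (simp add: t_def fr.hom_power)
  finally show ?thesis
    by (simp add: h_def monom_power)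
qed

theorem theorem1p2:
  fixes k :: nat
  assumes "k \<ge> 1"
  shows "degree (t_hankel period_doubling k) = k \<and>
         (\<forall>i. odd (coeff (t_hankel period_doubling k) i) \<longleftrightarrow> i = k)"
proof -
  let ?p = "t_hankel period_doubling k"
  have "of_int (coeff ?p i) = (coeff (monom 1 k) i :: bit)" for i
    unfolding map_poly_of_int_t_hankel[symmetric] by (simp add: coeff_map_poly)
  then have odd: "odd (coeff ?p i) \<longleftrightarrow> i = k" for i
    using of_int_bit_eq_one_iff[of "coeff ?p i"] by (auto split: if_splits)
  \<comment> \<open>Parities cannot exclude nonzero even coefficients above \<open>k\<close>; this
    bound comes from the matrix entries having degree at most 1.\<close>
  have "degree ?p \<le> 1 * k"
    unfolding t_hankel_def by (rule degree_det_le) auto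
  moreover have "k \<le> degree ?p"
    using odd[of k] by (intro le_degree) auto
  ultimately show ?thesis
    using odd by simp
qed

end
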